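(* Let $\gamma>0$. Let $s$ be a probability density on $\mathbb{R}$ with mean zero and unit variance, let $\{f_\beta\}$ be a parametric family of real-valued regression functions of $x$, and consider the location-scale model $$p_\theta(y|x)=\frac1\sigma\, s\!\left(\frac{y-f_\beta(x)}{\sigma}\right),\qquad \theta=(\beta,\sigma)\in\Theta,\ \sigma>0 .$$ Let $q$ be a probability density of the independent variable $x$, let $p_0(y|x)=p_{\theta_0}(y|x)$ for some $\theta_0\in\Theta$, and let $c_0(x)$ be a function with $0<c_0(x)\le1$ for all $x$. Let $S_{\mathrm{power}}(\cdot,\cdot\,;q)$ be the conditional density-power score with parameter $\gamma$. Then the problem $$\min_{c,\theta}\ S_{\mathrm{power}}(c_0p_0,\,cp_\theta;\,q)\quad\text{subject to } c>0,\ \theta\in\Theta,$$ where $c_0p_0$ denotes the function $c_0(x)p_0(y|x)$ and $c$ is a constant, has the optimal solution $$\theta=\theta_0,\qquad c=\int c_0(x)q(x)\,dx .$$ Moreover $\int c_0(x)q(x)\,dx\le1$, and the same pair is an optimal solution of the problem with the additional constraint $c\le1$.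
   Context: For non-negative functions $f(y|x)$, $g(y|x)$ and a probability density $q(x)$, the conditional density-power score is $$S_{\mathrm{power}}(f,g;q)=\int q(x)\left\{\gamma\int g(y|x)^{1+\gamma}dy-(1+\gamma)\int f(y|x)\,g(y|x)^\gamma dy\right\}dx .$$ All integrals appearing are assumed to exist and be finite (in particular $\int s(z)^{1+\gamma}dz<\infty$), and all functions are measurable. *)

theory Defs
  imports "HOL-Analysis.Analysis"
begin

definition prob_density :: "'a measure \<Rightarrow> ('a \<Rightarrow> real) \<Rightarrow> bool" where
  "prob_density M q \<longleftrightarrow>
     q \<in> borel_measurable M \<and> (\<forall>x\<in>space M. 0 \<le> q x) \<and> has_bochner_integral M q 1"

text \<open>A conditional function $f(y|x)$ is written \<open>f x y\<close>. The measure \<open>M\<close> is the reference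
  measure \<open>dx\<close> of the independent variable (for example \<open>lborel\<close> on a Euclidean space).\<close>

definition S_power ::
  "real \<Rightarrow> 'a measure \<Rightarrow> ('a \<Rightarrow> real \<Rightarrow> real) \<Rightarrow> ('a \<Rightarrow> real \<Rightarrow> real) \<Rightarrow> ('a \<Rightarrow> real) \<Rightarrow> real" where
  "S_power \<gamma> M f g q =
     (\<integral>x. q x * (\<gamma> * (\<integral>y. g x y powr (1 + \<gamma>) \<partial>lborel)
               - (1 + \<gamma>) * (\<integral>y. f x y * g x y powr \<gamma> \<partial>lborel)) \<partial>M)"

definition location_scale ::
  "(real \<Rightarrow> real) \<Rightarrow> ('b \<Rightarrow> 'a \<Rightarrow> real) \<Rightarrow> 'b \<times> real \<Rightarrow> 'a \<Rightarrow> real \<Rightarrow> real" where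
  "location_scale s f \<theta> x y = (case \<theta> of (\<beta>, \<sigma>) \<Rightarrow> 1 / \<sigma> * s ((y - f \<beta> x) / \<sigma>))"

end

theory Submission
  imports Defs
begin

text \<open>Write \<open>C = \<integral> c0 q\<close> and \<open>A\<^sub>\<theta> = \<integral> p\<^sub>\<theta>(y|x)\<^sup>1\<^sup>+\<^sup>\<gamma> dy\<close>. In a location-scale model \<open>A\<^sub>\<theta>\<close> does not depend
  on \<open>x\<close> (lemma \<open>location_scale_powr_integral\<close>); this is what makes a constant \<open>c\<close> sufficient although
  \<open>c0\<close> varies. Young's inequality \<open>(1 + \<gamma>) a b\<^sup>\<gamma> \<le> a\<^sup>1\<^sup>+\<^sup>\<gamma> + \<gamma> b\<^sup>1\<^sup>+\<^sup>\<gamma>\<close>, applied pointwise to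
  \<open>a = C p\<^sub>\<theta>\<^sub>0(y|x)\<close> and \<open>b = c p\<^sub>\<theta>(y|x)\<close> and integrated over \<open>y\<close>, bounds the cross term by
  \<open>(1 + \<gamma>) C c\<^sup>\<gamma> \<integral> p\<^sub>\<theta>\<^sub>0 p\<^sub>\<theta>\<^sup>\<gamma> dy \<le> C\<^sup>1\<^sup>+\<^sup>\<gamma> A\<^sub>\<theta>\<^sub>0 + \<gamma> c\<^sup>1\<^sup>+\<^sup>\<gamma> A\<^sub>\<theta>\<close>, whose right-hand side is free of \<open>x\<close>.
  Averaging this with the weight \<open>c0 q / C\<close>, which has integral one, makes the terms in \<open>A\<^sub>\<theta>\<close>
  cancel against the first part of the score and leaves
  \<open>S_power (c0 p\<^sub>\<theta>\<^sub>0, c p\<^sub>\<theta>; q) \<ge> - C\<^sup>1\<^sup>+\<^sup>\<gamma> A\<^sub>\<theta>\<^sub>0\<close> (lemma \<open>S_power_lower_bound\<close>). At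
  \<open>c = C\<close>, \<open>\<theta> = \<theta>0\<close> the bound is attained (lemma \<open>S_power_at_truth\<close>).\<close>

section \<open>Young's inequality for density powers\<close>

lemma powr_one_plus_split:
  fixes a \<gamma> :: real
  assumes "0 \<le> a"
  shows "a powr (1 + \<gamma>) = a * a powr \<gamma>"
  using assms by (cases "a = 0") (auto simp: powr_add)

lemma Youngs_inequality_density_power:
  fixes a b \<gamma> :: real
  assumes "0 < \<gamma>" "0 \<le> a" "0 \<le> b"
  shows "(1 + \<gamma>) * (a * b powr \<gamma>) \<le> a powr (1 + \<gamma>) + \<gamma> * b powr (1 + \<gamma>)"
proof -
  have "a * b powr \<gamma> \<le> a powr (1 + \<gamma>) / (1 + \<gamma>) + (b powr \<gamma>) powr ((1 + \<gamma>) / \<gamma>) / ((1 + \<gamma>) / \<gamma>)"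
    using assms by (intro Youngs_inequality) (auto simp: field_simps)
  also have "(b powr \<gamma>) powr ((1 + \<gamma>) / \<gamma>) = b powr (1 + \<gamma>)"
    using assms by (simp add: powr_powr)
  also have "a powr (1 + \<gamma>) / (1 + \<gamma>) + b powr (1 + \<gamma>) / ((1 + \<gamma>) / \<gamma>)
               = (a powr (1 + \<gamma>) + \<gamma> * b powr (1 + \<gamma>)) / (1 + \<gamma>)"
    unfolding divide_divide_eq_right by (simp add: add_divide_distrib mult.commute)
  finally show ?thesis
    using assms by (simp add: pos_le_divide_eq mult.commute)
qed

lemma integrable_density_power_cross:
  fixes u v :: "'a \<Rightarrow> real"
  assumes "0 < \<gamma>"
    and [measurable]: "u \<in> borel_measurable N" "v \<in> borel_measurable N"
    and nonneg: "\<And>y. 0 \<le> u y" "\<And>y. 0 \<le> v y"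
    and int: "integrable N (\<lambda>y. u y powr (1 + \<gamma>))" "integrable N (\<lambda>y. v y powr (1 + \<gamma>))"
  shows "integrable N (\<lambda>y. u y * v y powr \<gamma>)"
proof (rule Bochner_Integration.integrable_bound)
  show "integrable N (\<lambda>y. (u y powr (1 + \<gamma>) + \<gamma> * v y powr (1 + \<gamma>)) / (1 + \<gamma>))"
    using int by simp
  show "AE y in N. norm (u y * v y powr \<gamma>)
                     \<le> norm ((u y powr (1 + \<gamma>) + \<gamma> * v y powr (1 + \<gamma>)) / (1 + \<gamma>))"
    using Youngs_inequality_density_power[OF \<open>0 < \<gamma>\<close> nonneg] assms(1) nonneg
    by (intro AE_I2) (simp add: field_simps)
qed measurable

lemma integral_density_power_cross_le:
  fixes u v :: "'a \<Rightarrow> real"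
  assumes "0 < \<gamma>"
    and meas: "u \<in> borel_measurable N" "v \<in> borel_measurable N"
    and nonneg: "\<And>y. 0 \<le> u y" "\<And>y. 0 \<le> v y"
    and u: "has_bochner_integral N (\<lambda>y. u y powr (1 + \<gamma>)) A"
    and v: "has_bochner_integral N (\<lambda>y. v y powr (1 + \<gamma>)) B"
    and "0 \<le> a" "0 \<le> b"
  shows "(1 + \<gamma>) * (a * b powr \<gamma>) * (\<integral>y. u y * v y powr \<gamma> \<partial>N)
           \<le> a powr (1 + \<gamma>) * A + \<gamma> * (b powr (1 + \<gamma>) * B)"
proof -
  have int: "integrable N (\<lambda>y. u y powr (1 + \<gamma>))" "integrable N (\<lambda>y. v y powr (1 + \<gamma>))"
    using u v by (auto simp: has_bochner_integral_iff)
  have "(1 + \<gamma>) * (a * b powr \<gamma>) * (\<integral>y. u y * v y powr \<gamma> \<partial>N)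
          = (\<integral>y. (1 + \<gamma>) * (a * b powr \<gamma>) * (u y * v y powr \<gamma>) \<partial>N)"
    by simp
  also have "\<dots> \<le> (\<integral>y. a powr (1 + \<gamma>) * u y powr (1 + \<gamma>)
                        + \<gamma> * (b powr (1 + \<gamma>) * v y powr (1 + \<gamma>)) \<partial>N)"
  proof (rule integral_mono)
    show "integrable N (\<lambda>y. (1 + \<gamma>) * (a * b powr \<gamma>) * (u y * v y powr \<gamma>))"
      using integrable_density_power_cross[OF assms(1) meas nonneg int] by simp
    show "integrable N (\<lambda>y. a powr (1 + \<gamma>) * u y powr (1 + \<gamma>)
                              + \<gamma> * (b powr (1 + \<gamma>) * v y powr (1 + \<gamma>)))"
      using int by simp
    fix y
    show "(1 + \<gamma>) * (a * b powr \<gamma>) * (u y * v y powr \<gamma>)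
            \<le> a powr (1 + \<gamma>) * u y powr (1 + \<gamma>) + \<gamma> * (b powr (1 + \<gamma>) * v y powr (1 + \<gamma>))"
      using Youngs_inequality_density_power[of \<gamma> "a * u y" "b * v y"] assms(1,8,9) nonneg
      by (simp add: powr_mult mult_ac)
  qed
  also have "\<dots> = a powr (1 + \<gamma>) * A + \<gamma> * (b powr (1 + \<gamma>) * B)"
    using u v by (simp add: has_bochner_integral_iff)
  finally show ?thesis .
qed

section \<open>The density-power score of scaled conditional functions\<close>

lemma S_power_scaled:
  assumes "0 < c"
    and nonneg: "\<And>x y. x \<in> space M \<Longrightarrow> 0 \<le> v x y"
    and v: "\<And>x. x \<in> space M \<Longrightarrow> has_bochner_integral lborel (\<lambda>y. v x y powr (1 + \<gamma>)) B"
  shows "S_power \<gamma> M (\<lambda>x y. c0 x * u x y) (\<lambda>x y. c * v x y) q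
           = (\<integral>x. q x * (\<gamma> * (c powr (1 + \<gamma>) * B)
                - (1 + \<gamma>) * (c powr \<gamma> * (c0 x * (\<integral>y. u x y * v x y powr \<gamma> \<partial>lborel)))) \<partial>M)"
  unfolding S_power_def
proof (rule Bochner_Integration.integral_cong[OF refl])
  fix x assume x: "x \<in> space M"
  have "(\<integral>y. (c * v x y) powr (1 + \<gamma>) \<partial>lborel) = (\<integral>y. c powr (1 + \<gamma>) * v x y powr (1 + \<gamma>) \<partial>lborel)"
    using assms(1) nonneg[OF x] by (simp add: powr_mult)
  also have "\<dots> = c powr (1 + \<gamma>) * B"
    using v[OF x] by (simp add: has_bochner_integral_iff)
  finally have 1: "(\<integral>y. (c * v x y) powr (1 + \<gamma>) \<partial>lborel) = c powr (1 + \<gamma>) * B" .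
  have "(\<integral>y. c0 x * u x y * (c * v x y) powr \<gamma> \<partial>lborel)
          = (\<integral>y. (c powr \<gamma> * c0 x) * (u x y * v x y powr \<gamma>) \<partial>lborel)"
    using assms(1) nonneg[OF x] by (simp add: powr_mult mult_ac)
  also have "\<dots> = c powr \<gamma> * (c0 x * (\<integral>y. u x y * v x y powr \<gamma> \<partial>lborel))"
    by simp
  finally show "q x * (\<gamma> * (\<integral>y. (c * v x y) powr (1 + \<gamma>) \<partial>lborel)
                  - (1 + \<gamma>) * (\<integral>y. c0 x * u x y * (c * v x y) powr \<gamma> \<partial>lborel))
      = q x * (\<gamma> * (c powr (1 + \<gamma>) * B)
                - (1 + \<gamma>) * (c powr \<gamma> * (c0 x * (\<integral>y. u x y * v x y powr \<gamma> \<partial>lborel))))"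
    unfolding 1 by simp
qed

lemma integrable_weighted_density:
  assumes "prob_density M q" and [measurable]: "w \<in> borel_measurable M"
    and "\<And>x. x \<in> space M \<Longrightarrow> \<bar>w x\<bar> \<le> (K :: real)"
  shows "integrable M (\<lambda>x. w x * q x)"
proof (rule Bochner_Integration.integrable_bound)
  have [measurable]: "q \<in> borel_measurable M" and q: "\<And>x. x \<in> space M \<Longrightarrow> 0 \<le> q x"
    using assms(1) by (auto simp: prob_density_def)
  show "integrable M (\<lambda>x. K * q x)"
    using assms(1) by (auto simp: prob_density_def has_bochner_integral_iff)
  show "(\<lambda>x. w x * q x) \<in> borel_measurable M"
    by measurable
  show "AE x in M. norm (w x * q x) \<le> norm (K * q x)"
  proof (rule AE_I2)
    fix x assume x: "x \<in> space M"
    then have "\<bar>w x\<bar> * q x \<le> \<bar>K\<bar> * q x"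
      using assms(3)[OF x] q[OF x] by (intro mult_right_mono) auto
    then show "norm (w x * q x) \<le> norm (K * q x)"
      using q[OF x] by (simp add: abs_mult)
  qed
qed

lemma weighted_density_integral:
  assumes q: "prob_density M q" and c0: "c0 \<in> borel_measurable M"
    and bounds: "\<And>x. x \<in> space M \<Longrightarrow> 0 < c0 x \<and> c0 x \<le> 1"
  shows "integrable M (\<lambda>x. c0 x * q x)"
    and "0 < (\<integral>x. c0 x * q x \<partial>M)"
    and "(\<integral>x. c0 x * q x \<partial>M) \<le> 1"
proof -
  have qn: "\<And>x. x \<in> space M \<Longrightarrow> 0 \<le> q x" and qi: "integrable M q" and q1: "integral\<^sup>L M q = 1"
    using q by (auto simp: prob_density_def has_bochner_integral_iff)
  show int: "integrable M (\<lambda>x. c0 x * q x)"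
    using bounds by (intro integrable_weighted_density[OF q c0, of 1]) force
  have "(\<integral>x. c0 x * q x \<partial>M) \<le> integral\<^sup>L M q"
    using bounds qn by (intro integral_mono[OF int qi] mult_left_le_one_le) (auto intro: less_imp_le)
  then show "(\<integral>x. c0 x * q x \<partial>M) \<le> 1"
    using q1 by simp
  have nonneg: "AE x in M. 0 \<le> c0 x * q x"
    using bounds qn by (intro AE_I2) (simp add: less_imp_le)
  have "(\<integral>x. c0 x * q x \<partial>M) \<noteq> 0"
  proof
    assume "(\<integral>x. c0 x * q x \<partial>M) = 0"
    then have "AE x in M. c0 x * q x = 0"
      using integral_nonneg_eq_0_iff_AE[OF int nonneg] by simp
    then have "AE x in M. q x = 0"
    proof (rule AE_mp, intro AE_I2 impI)
      fix x assume "x \<in> space M" "c0 x * q x = 0"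
      then show "q x = 0"
        using bounds[of x] by auto
    qed
    then have "integral\<^sup>L M q = 0"
      by (rule integral_eq_zero_AE)
    then show False
      using q1 by simp
  qed
  then show "0 < (\<integral>x. c0 x * q x \<partial>M)"
    using integral_nonneg_AE[OF nonneg] by simp
qed

text \<open>The inner integrals \<open>A\<close> and \<open>B\<close> of \<open>u\<^sup>1\<^sup>+\<^sup>\<gamma>\<close> and \<open>v\<^sup>1\<^sup>+\<^sup>\<gamma>\<close> are assumed to be the same for all \<open>x\<close>.
  The bound involves neither \<open>c\<close> nor \<open>v\<close>.\<close>

lemma S_power_lower_bound:
  fixes c0 :: "'a \<Rightarrow> real"
  assumes "0 < \<gamma>" "0 < c"
    and q: "prob_density M q" and c0: "c0 \<in> borel_measurable M"
    and bounds: "\<And>x. x \<in> space M \<Longrightarrow> 0 < c0 x \<and> c0 x \<le> 1"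
    and u_meas: "(\<lambda>(x, y). u x y) \<in> borel_measurable (M \<Otimes>\<^sub>M lborel)"
    and v_meas: "(\<lambda>(x, y). v x y) \<in> borel_measurable (M \<Otimes>\<^sub>M lborel)"
    and nonneg: "\<And>x y. x \<in> space M \<Longrightarrow> 0 \<le> u x y" "\<And>x y. x \<in> space M \<Longrightarrow> 0 \<le> v x y"
    and u: "\<And>x. x \<in> space M \<Longrightarrow> has_bochner_integral lborel (\<lambda>y. u x y powr (1 + \<gamma>)) A"
    and v: "\<And>x. x \<in> space M \<Longrightarrow> has_bochner_integral lborel (\<lambda>y. v x y powr (1 + \<gamma>)) B"
  shows "- ((\<integral>x. c0 x * q x \<partial>M) powr (1 + \<gamma>) * A)
           \<le> S_power \<gamma> M (\<lambda>x y. c0 x * u x y) (\<lambda>x y. c * v x y) q"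
proof -
  define C where "C = (\<integral>x. c0 x * q x \<partial>M)"
  define J where "J x = (\<integral>y. u x y * v x y powr \<gamma> \<partial>lborel)" for x
  define R where "R = C powr (1 + \<gamma>) * A + \<gamma> * (c powr (1 + \<gamma>) * B)"
  have C: "0 < C" and C_int: "integrable M (\<lambda>x. c0 x * q x)"
    using weighted_density_integral[OF q c0 bounds] by (auto simp: C_def)
  have qn: "\<And>x. x \<in> space M \<Longrightarrow> 0 \<le> q x" and qi: "integrable M q" and q1: "integral\<^sup>L M q = 1"
    using q by (auto simp: prob_density_def has_bochner_integral_iff)
  note [measurable] = c0 u_meas v_meas
  have [measurable]: "J \<in> borel_measurable M"
    unfolding J_def by measurable
  have slice: "u x \<in> borel_measurable lborel" "v x \<in> borel_measurable lborel" if "x \<in> space M" for x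
    using measurable_Pair2[OF u_meas that] measurable_Pair2[OF v_meas that] by simp_all
  \<comment> \<open>The factor \<open>C\<close> on \<open>u\<close> makes the bound sharp at \<open>c = C\<close>, \<open>v = u\<close>; \<open>R\<close> does not depend on \<open>x\<close>.\<close>
  have cross: "(1 + \<gamma>) * (C * c powr \<gamma>) * J x \<le> R" if x: "x \<in> space M" for x
    unfolding J_def R_def using assms(1,2) C
    by (intro integral_density_power_cross_le slice[OF x] nonneg[OF x] u[OF x] v[OF x]) auto
  have J_nonneg: "0 \<le> J x" if "x \<in> space M" for x
    unfolding J_def using nonneg[OF that] by (intro integral_nonneg_AE AE_I2) simp
  have J_le: "J x \<le> R / ((1 + \<gamma>) * (C * c powr \<gamma>))" if "x \<in> space M" for x
    using cross[OF that] assms(1,2) C by (simp add: pos_le_divide_eq mult_ac)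
  have cJ_int: "integrable M (\<lambda>x. c0 x * J x * q x)"
  proof (rule integrable_weighted_density[OF q])
    fix x assume x: "x \<in> space M"
    have "c0 x * J x \<le> J x"
      using bounds[OF x] J_nonneg[OF x] by (intro mult_left_le_one_le) auto
    then show "\<bar>c0 x * J x\<bar> \<le> R / ((1 + \<gamma>) * (C * c powr \<gamma>))"
      using J_le[OF x] J_nonneg[OF x] bounds[OF x] by (simp add: abs_mult)
  qed measurable
  \<comment> \<open>Since \<open>q\<close> and \<open>c0 q / C\<close> both have integral one, the terms in \<open>B\<close> cancel.\<close>
  have "- (C powr (1 + \<gamma>) * A) = \<gamma> * (c powr (1 + \<gamma>) * B) * integral\<^sup>L M q - R / C * C"
    using C q1 by (simp add: R_def)
  also have "\<dots> = (\<integral>x. \<gamma> * (c powr (1 + \<gamma>) * B) * q x - R / C * (c0 x * q x) \<partial>M)"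
    using qi C_int by (simp flip: C_def)
  also have "\<dots> \<le> (\<integral>x. q x * (\<gamma> * (c powr (1 + \<gamma>) * B)
                              - (1 + \<gamma>) * (c powr \<gamma> * (c0 x * J x))) \<partial>M)"
  proof (rule integral_mono)
    show "integrable M (\<lambda>x. \<gamma> * (c powr (1 + \<gamma>) * B) * q x - R / C * (c0 x * q x))"
      using qi C_int by simp
    have "integrable M (\<lambda>x. \<gamma> * (c powr (1 + \<gamma>) * B) * q x
                              - (1 + \<gamma>) * c powr \<gamma> * (c0 x * J x * q x))"
      using qi cJ_int by simp
    then show "integrable M (\<lambda>x. q x * (\<gamma> * (c powr (1 + \<gamma>) * B)
                              - (1 + \<gamma>) * (c powr \<gamma> * (c0 x * J x))))"
      by (simp add: algebra_simps)
    fix x assume x: "x \<in> space M"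
    have "(1 + \<gamma>) * c powr \<gamma> * J x \<le> R / C"
      using cross[OF x] C by (simp add: pos_le_divide_eq mult_ac)
    then have "(1 + \<gamma>) * c powr \<gamma> * J x * (c0 x * q x) \<le> R / C * (c0 x * q x)"
      using bounds[OF x] qn[OF x] by (intro mult_right_mono) auto
    then show "\<gamma> * (c powr (1 + \<gamma>) * B) * q x - R / C * (c0 x * q x)
                 \<le> q x * (\<gamma> * (c powr (1 + \<gamma>) * B) - (1 + \<gamma>) * (c powr \<gamma> * (c0 x * J x)))"
      by (simp add: right_diff_distrib mult_ac)
  qed
  also have "\<dots> = S_power \<gamma> M (\<lambda>x y. c0 x * u x y) (\<lambda>x y. c * v x y) q"
    unfolding J_def by (rule S_power_scaled[symmetric, OF assms(2) nonneg(2) v])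
  finally show ?thesis
    by (simp add: C_def)
qed

lemma S_power_at_truth:
  fixes c0 :: "'a \<Rightarrow> real"
  assumes q: "prob_density M q" and c0: "c0 \<in> borel_measurable M"
    and bounds: "\<And>x. x \<in> space M \<Longrightarrow> 0 < c0 x \<and> c0 x \<le> 1"
    and nonneg: "\<And>x y. x \<in> space M \<Longrightarrow> 0 \<le> u x y"
    and u: "\<And>x. x \<in> space M \<Longrightarrow> has_bochner_integral lborel (\<lambda>y. u x y powr (1 + \<gamma>)) A"
  shows "S_power \<gamma> M (\<lambda>x y. c0 x * u x y) (\<lambda>x y. (\<integral>x. c0 x * q x \<partial>M) * u x y) q
           = - ((\<integral>x. c0 x * q x \<partial>M) powr (1 + \<gamma>) * A)"
proof -
  define C where "C = (\<integral>x. c0 x * q x \<partial>M)"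
  have C: "0 < C" and C_int: "integrable M (\<lambda>x. c0 x * q x)"
    using weighted_density_integral[OF q c0 bounds] by (auto simp: C_def)
  have qi: "integrable M q" and q1: "integral\<^sup>L M q = 1"
    using q by (auto simp: prob_density_def has_bochner_integral_iff)
  have A: "(\<integral>y. u x y * u x y powr \<gamma> \<partial>lborel) = A" if "x \<in> space M" for x
    using u[OF that] nonneg[OF that]
    by (simp add: has_bochner_integral_iff flip: powr_one_plus_split)
  have "S_power \<gamma> M (\<lambda>x y. c0 x * u x y) (\<lambda>x y. C * u x y) q
          = (\<integral>x. q x * (\<gamma> * (C powr (1 + \<gamma>) * A)
                - (1 + \<gamma>) * (C powr \<gamma> * (c0 x * (\<integral>y. u x y * u x y powr \<gamma> \<partial>lborel)))) \<partial>M)"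
    by (rule S_power_scaled[OF C nonneg u])
  also have "\<dots> = (\<integral>x. \<gamma> * (C powr (1 + \<gamma>) * A) * q x
                       - (1 + \<gamma>) * (C powr \<gamma> * A) * (c0 x * q x) \<partial>M)"
    by (rule Bochner_Integration.integral_cong[OF refl]) (simp only: A right_diff_distrib mult_ac)
  also have "\<dots> = \<gamma> * (C powr (1 + \<gamma>) * A) - (1 + \<gamma>) * (C powr \<gamma> * A) * C"
    using qi C_int q1 by (simp flip: C_def)
  also have "\<dots> = - (C powr (1 + \<gamma>) * A)"
    using C by (simp add: powr_one_plus_split algebra_simps)
  finally show ?thesis
    by (simp add: C_def)
qed

section \<open>Location-scale models\<close>

lemma location_scale_nonneg:
  assumes "\<And>z. 0 \<le> s z" "0 < \<sigma>"
  shows "0 \<le> location_scale s f (\<beta>, \<sigma>) x y"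
  using assms by (simp add: location_scale_def)

lemma measurable_location_scale:
  assumes [measurable]: "s \<in> borel_measurable borel" "f \<beta> \<in> borel_measurable M"
  shows "(\<lambda>(x, y). location_scale s f (\<beta>, \<sigma>) x y) \<in> borel_measurable (M \<Otimes>\<^sub>M lborel)"
  unfolding location_scale_def by simp

text \<open>The substitution \<open>z = (y - f\<^sub>\<beta>(x)) / \<sigma>\<close> removes the location, so the value is free of \<open>x\<close>.\<close>

lemma location_scale_powr_integral:
  assumes "integrable lborel (\<lambda>z. s z powr (1 + \<gamma>))" "\<And>z. 0 \<le> s z" "0 < \<sigma>"
  shows "has_bochner_integral lborel (\<lambda>y. location_scale s f (\<beta>, \<sigma>) x y powr (1 + \<gamma>))
           ((1 / \<sigma>) powr (1 + \<gamma>) * (\<sigma> * (\<integral>z. s z powr (1 + \<gamma>) \<partial>lborel)))"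
proof -
  have "has_bochner_integral lborel (\<lambda>z. s z powr (1 + \<gamma>)) (\<integral>z. s z powr (1 + \<gamma>) \<partial>lborel)"
    using assms(1) by (rule has_bochner_integral_integrable)
  then have "has_bochner_integral lborel (\<lambda>y. s (- f \<beta> x / \<sigma> + 1 / \<sigma> * y) powr (1 + \<gamma>))
               ((\<integral>z. s z powr (1 + \<gamma>) \<partial>lborel) /\<^sub>R \<bar>1 / \<sigma>\<bar>)"
    using assms(3)
    by (subst (asm) lborel_has_bochner_integral_real_affine_iff[where c = "1 / \<sigma>" and t = "- f \<beta> x / \<sigma>"])
      auto
  moreover have "- f \<beta> x / \<sigma> + 1 / \<sigma> * y = (y - f \<beta> x) / \<sigma>" for y
    by (simp add: diff_divide_distrib)
  ultimately have "has_bochner_integral lborel (\<lambda>y. s ((y - f \<beta> x) / \<sigma>) powr (1 + \<gamma>))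
               (\<sigma> * (\<integral>z. s z powr (1 + \<gamma>) \<partial>lborel))"
    using assms(3) by simp
  then have "has_bochner_integral lborel
               (\<lambda>y. (1 / \<sigma>) powr (1 + \<gamma>) * s ((y - f \<beta> x) / \<sigma>) powr (1 + \<gamma>))
               ((1 / \<sigma>) powr (1 + \<gamma>) * (\<sigma> * (\<integral>z. s z powr (1 + \<gamma>) \<partial>lborel)))"
    by (rule has_bochner_integral_mult_right)
  then show ?thesis
    using assms(2,3) by (simp add: location_scale_def powr_mult powr_divide)
qed

section \<open>Optimality of the true parameter\<close>

theorem mainTheorem3:
  fixes \<gamma> :: real and s :: "real \<Rightarrow> real"
    and M :: "'a measure" and q c0 :: "'a \<Rightarrow> real"
    and f :: "'b \<Rightarrow> 'a \<Rightarrow> real"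
    and \<Theta> :: "('b \<times> real) set" and \<theta>0 :: "'b \<times> real"
  assumes "\<gamma> > 0"
    and "prob_density lborel s"
    and "has_bochner_integral lborel (\<lambda>z. z * s z) 0"
    and "has_bochner_integral lborel (\<lambda>z. z\<^sup>2 * s z) 1"
    and "integrable lborel (\<lambda>z. s z powr (1 + \<gamma>))"
    and "\<And>\<beta> \<sigma>. (\<beta>, \<sigma>) \<in> \<Theta> \<Longrightarrow> \<sigma> > 0"
    and "\<And>\<beta> \<sigma>. (\<beta>, \<sigma>) \<in> \<Theta> \<Longrightarrow> f \<beta> \<in> borel_measurable M"
    and "prob_density M q"
    and "\<theta>0 \<in> \<Theta>"
    and "c0 \<in> borel_measurable M"
    and "\<And>x. x \<in> space M \<Longrightarrow> 0 < c0 x \<and> c0 x \<le> 1"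
  shows "is_arg_min
           (\<lambda>(c, \<theta>). S_power \<gamma> M (\<lambda>x y. c0 x * location_scale s f \<theta>0 x y)
                                  (\<lambda>x y. c * location_scale s f \<theta> x y) q)
           (\<lambda>(c, \<theta>). c > 0 \<and> \<theta> \<in> \<Theta>)
           ((\<integral>x. c0 x * q x \<partial>M), \<theta>0)
       \<and> (\<integral>x. c0 x * q x \<partial>M) \<le> 1
       \<and> is_arg_min
           (\<lambda>(c, \<theta>). S_power \<gamma> M (\<lambda>x y. c0 x * location_scale s f \<theta>0 x y)
                                  (\<lambda>x y. c * location_scale s f \<theta> x y) q)
           (\<lambda>(c, \<theta>). c > 0 \<and> c \<le> 1 \<and> \<theta> \<in> \<Theta>)
           ((\<integral>x. c0 x * q x \<partial>M), \<theta>0)"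
proof -
  define C where "C = (\<integral>x. c0 x * q x \<partial>M)"
  define S where "S = (\<lambda>(c, \<theta>). S_power \<gamma> M (\<lambda>x y. c0 x * location_scale s f \<theta>0 x y)
                                  (\<lambda>x y. c * location_scale s f \<theta> x y) q)"
  have s: "s \<in> borel_measurable borel" "\<And>z. 0 \<le> s z"
    using assms(2) by (auto simp: prob_density_def)
  obtain \<beta>0 \<sigma>0 where \<theta>0: "\<theta>0 = (\<beta>0, \<sigma>0)"
    by (cases \<theta>0)
  have \<sigma>0: "0 < \<sigma>0" and f0: "f \<beta>0 \<in> borel_measurable M"
    using assms(6,7,9) \<theta>0 by auto
  define A where "A = (1 / \<sigma>0) powr (1 + \<gamma>) * (\<sigma>0 * (\<integral>z. s z powr (1 + \<gamma>) \<partial>lborel))"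
  note p0 = location_scale_nonneg[OF s(2) \<sigma>0] measurable_location_scale[where f = f and \<beta> = \<beta>0, OF s(1) f0]
    location_scale_powr_integral[OF assms(5) s(2) \<sigma>0, folded A_def]
  have C: "0 < C" "C \<le> 1"
    using weighted_density_integral[OF assms(8,10,11)] by (auto simp: C_def)
  have attained: "S (C, \<theta>0) = - (C powr (1 + \<gamma>) * A)"
    unfolding S_def C_def \<theta>0 prod.case
    by (rule S_power_at_truth[OF assms(8,10,11) p0(1,3)])
  have minimal: "S (C, \<theta>0) \<le> S (c, \<theta>)" if "0 < c" "\<theta> \<in> \<Theta>" for c \<theta>
  proof -
    obtain \<beta> \<sigma> where \<theta>: "\<theta> = (\<beta>, \<sigma>)"
      by (cases \<theta>)
    have \<sigma>: "0 < \<sigma>" and f: "f \<beta> \<in> borel_measurable M"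
      using assms(6,7) that(2) \<theta> by auto
    show ?thesis
      unfolding attained unfolding S_def C_def \<theta>0 \<theta> prod.case
      by (rule S_power_lower_bound[OF assms(1) that(1) assms(8,10,11) p0(2)
            measurable_location_scale[where f = f and \<beta> = \<beta>, OF s(1) f] p0(1) location_scale_nonneg[OF s(2) \<sigma>] p0(3)
            location_scale_powr_integral[OF assms(5) s(2) \<sigma>]])
  qed
  show ?thesis
    unfolding C_def[symmetric] S_def[symmetric] is_arg_min_def
    using C assms(9) minimal by (auto simp: not_less)
qed

end
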